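(* Let $\mathcal{P}$ be a family of distributions on $\mathcal{X}$ with real-valued parameter $\theta:\mathcal{P}\to\mathbb{R}$, let $P_0\in\mathcal{P}$, and let $\mathcal{Q}_\varepsilon$ be the collection of (sequentially interactive) $(2,\varepsilon^2)$-locally Rényi private channels. With $L_{\mathrm{sq}}(t)=t^2$, for every $n\in\mathbb{N}$, $$\mathfrak{M}^{\mathrm{loc}}_n(P_0,L_{\mathrm{sq}},\mathcal{P},\mathcal{Q}_\varepsilon)\ \ge\ \frac{1}{16}\,\omega_{TV}^2\!\left(\frac{1}{2\sqrt{2n\varepsilon^2}};P_0,\mathcal{P}\right).$$
   Context: Data $X_1,\dots,X_n$ are i.i.d. from $P$ on $\mathcal{X}$. A sequentially interactive channel $Q$ produces private observations $Z_1,\dots,Z_n\in\mathcal{Z}$ via Markov kernels: $Z_i\mid X_i=x,Z_{1:i-1}=z_{1:i-1}\sim Q(\cdot\mid x,z_{1:i-1})$. The channel is $(2,\varepsilon^2)$-Rényi locally private if for all $i$, all $x,x'\in\mathcal{X}$ and all $z_{1:i-1}$, $D_2(Q(\cdot\mid x,z_{1:i-1})\|Q(\cdot\mid x',z_{1:i-1}))\le\varepsilon^2$, where $D_2(P\|Q)=\log\int(dP/dQ)^2dQ$. The local minimax risk is $$\mathfrak{M}^{\mathrm{loc}}_n(P_0,L,\mathcal{P},\mathcal{Q})=\sup_{P_1\in\mathcal{P}}\ \inf_{\hat\theta,\,Q\in\mathcal{Q}}\ \max_{P\in\{P_0,P_1\}}\mathbb{E}_{Q\circ P}\big[L(\hat\theta(Z_1,\dots,Z_n)-\theta(P))\big],$$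 where $Q\circ P$ denotes the law of $Z_{1:n}$ when $X_i\overset{iid}{\sim}P$ and $Z_i$ are drawn from $Q$, and the infimum is over all estimators $\hat\theta$ of $Z_{1:n}$. The variation modulus is $\omega_{TV}(\delta;P_0,\mathcal{P})=\sup_{P\in\mathcal{P}}\{|\theta(P)-\theta(P_0)|:\|P-P_0\|_{TV}\le\delta\}$, with $\|P-P_0\|_{TV}=\sup_A|P(A)-P_0(A)|$.
   Formalization: The formal theorem assumes 0 < ε ≤ 1; for large ε the claim as stated is false (for instance ε² = log n with n = 10⁶ and binary data and observations), and at ε = 0 the argument of the modulus is undefined. *)

theory Defs
  imports "HOL-Probability.Probability"
begin

definition tv_dist :: "'a measure \<Rightarrow> 'a measure \<Rightarrow> real" where
  "tv_dist P Q = (SUP A\<in>sets P. \<bar>measure P A - measure Q A\<bar>)"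

(* D_2(P || Q) = log \<integral> (dP/dQ)^2 dQ, and infinity when P has no density with respect
   to Q.  For probability measures the integral is at least 1, so the real logarithm is only
   taken at arguments in [1, \<infinity>). *)
definition renyi_div2 :: "'a measure \<Rightarrow> 'a measure \<Rightarrow> ereal" where
  "renyi_div2 P Q =
     (let I = (\<integral>\<^sup>+ z. (RN_deriv Q P z)\<^sup>2 \<partial>Q) in
      if absolutely_continuous Q P \<and> I < \<infinity> then ereal (ln (enn2real I)) else \<infinity>)"

(* Observations are numbered from 0: the kernel Q i produces the i-th private observation from
   the pair of the i-th datum and the history of the observations with indices in {..<i}.
   A channel for n observations is constrained only at the indices i < n. *)
type_synonym ('x, 'z) channel = "nat \<Rightarrow> 'x \<times> (nat \<Rightarrow> 'z) \<Rightarrow> 'z measure"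

definition seq_channels :: "'x measure \<Rightarrow> 'z measure \<Rightarrow> nat \<Rightarrow> ('x, 'z) channel set" where
  "seq_channels X Z n =
     {Q. \<forall>i<n. Q i \<in> X \<Otimes>\<^sub>M PiM {..<i} (\<lambda>_. Z) \<rightarrow>\<^sub>M prob_algebra Z}"

(* The bound in the (2, \<epsilon>^2)-Renyi condition is \<epsilon>^2, not \<epsilon>. *)
definition renyi_channels ::
  "'x measure \<Rightarrow> 'z measure \<Rightarrow> nat \<Rightarrow> real \<Rightarrow> ('x, 'z) channel set" where
  "renyi_channels X Z n \<epsilon> =
     {Q \<in> seq_channels X Z n.
        \<forall>i<n. \<forall>x\<in>space X. \<forall>x'\<in>space X. \<forall>z\<in>space (PiM {..<i} (\<lambda>_. Z)).
          renyi_div2 (Q i (x, z)) (Q i (x', z)) \<le> ereal (\<epsilon>\<^sup>2)}"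

(* The law of the first n private observations given the data sequence x. *)
primrec private_law_given ::
  "'z measure \<Rightarrow> ('x, 'z) channel \<Rightarrow> (nat \<Rightarrow> 'x) \<Rightarrow> nat \<Rightarrow> (nat \<Rightarrow> 'z) measure" where
  "private_law_given Z Q x 0 = return (PiM {..<0} (\<lambda>_. Z)) (\<lambda>_. undefined)"
| "private_law_given Z Q x (Suc i) =
     private_law_given Z Q x i \<bind>
       (\<lambda>z. distr (Q i (x i, z)) (PiM {..<Suc i} (\<lambda>_. Z)) (\<lambda>w. z(i := w)))"

(* Q \<circ> P: the marginal law of the first n private observations for i.i.d. data from P. *)
definition private_law ::
  "'z measure \<Rightarrow> ('x, 'z) channel \<Rightarrow> 'x measure \<Rightarrow> nat \<Rightarrow> (nat \<Rightarrow> 'z) measure" where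
  "private_law Z Q P n =
     PiM {..<n} (\<lambda>_. P) \<bind> (\<lambda>x. private_law_given Z Q x n)"

(* The coercion ennreal truncates negative values, so losses are meant to be nonnegative. *)
definition risk ::
  "'z measure \<Rightarrow> nat \<Rightarrow> (real \<Rightarrow> real) \<Rightarrow> ('x measure \<Rightarrow> real) \<Rightarrow>
   ((nat \<Rightarrow> 'z) \<Rightarrow> real) \<Rightarrow> ('x, 'z) channel \<Rightarrow> 'x measure \<Rightarrow> ennreal" where
  "risk Z n L \<theta> T Q P = (\<integral>\<^sup>+ z. ennreal (L (T z - \<theta> P)) \<partial>private_law Z Q P n)"

definition local_minimax_risk ::
  "'z measure \<Rightarrow> nat \<Rightarrow> ('x measure \<Rightarrow> real) \<Rightarrow>
   'x measure \<Rightarrow> (real \<Rightarrow> real) \<Rightarrow> 'x measure set \<Rightarrow> ('x, 'z) channel set \<Rightarrow> ennreal" where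
  "local_minimax_risk Z n \<theta> P0 L \<P> \<Q> =
     (SUP P1\<in>\<P>.
        INF (T, Q) \<in> borel_measurable (PiM {..<n} (\<lambda>_. Z)) \<times> \<Q>.
          max (risk Z n L \<theta> T Q P0) (risk Z n L \<theta> T Q P1))"

definition tv_modulus ::
  "('x measure \<Rightarrow> real) \<Rightarrow> real \<Rightarrow> 'x measure \<Rightarrow> 'x measure set \<Rightarrow> ennreal" where
  "tv_modulus \<theta> \<delta> P0 \<P> = (SUP P\<in>{P\<in>\<P>. tv_dist P P0 \<le> \<delta>}. ennreal \<bar>\<theta> P - \<theta> P0\<bar>)"

definition sq_loss :: "real \<Rightarrow> real" where
  "sq_loss t = t\<^sup>2"

end

theory Submission
  imports Defs
begin

text \<open>
  Two laws of the data that are close in total variation produce private observations that are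
  close in \<open>\<chi>\<^sup>2\<close>-divergence, and an estimator cannot tell apart two laws whose
  \<open>\<chi>\<^sup>2\<close>-divergence is bounded.

  Write \<open>M\<close> and \<open>M'\<close> for the laws of one private observation, with the history fixed, when the
  datum has law \<open>P\<close> or \<open>P'\<close>. For a bounded function \<open>h\<close> of the observation,
  \<open>M h - M' h = \<integral> (Q\<^sub>x h - M' h) d(P - P')(x)\<close>, so this difference is at most
  \<open>2 \<parallel>P - P'\<parallel> sup\<^sub>x \<bar>Q\<^sub>x h - M' h\<bar>\<close>, where \<open>\<parallel>\<cdot>\<parallel>\<close> is the total variation
  distance. Privacy bounds the \<open>\<chi>\<^sup>2\<close>-divergence of \<open>Q\<^sub>x\<close> from
  each \<open>Q\<^sub>y\<close>, hence from their mixture \<open>M'\<close>, by \<open>exp (\<epsilon>\<^sup>2) - 1\<close>, so the supremum is at most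
  \<open>sqrt (exp (\<epsilon>\<^sup>2) - 1)\<close> times the standard deviation of \<open>h\<close> under \<open>M'\<close>. Thus each observation
  multiplies \<open>1 + \<chi>\<^sup>2\<close> by at most \<open>1 + 4 \<parallel>P - P'\<parallel>\<^sup>2 (exp (\<epsilon>\<^sup>2) - 1)\<close>
  (\<open>moment_dominated_kernel_mixture\<close>), and these factors multiply along the sequence
  (\<open>moment_dominated_private_law\<close>). At the radius \<open>1 / (2 sqrt (2 n \<epsilon>\<^sup>2))\<close> a factor is at most
  \<open>1 + 1 / n\<close>, so the product is at most \<open>exp 1 \<le> 9\<close>. The triangle inequality for the two
  parameter values and the Cauchy-Schwarz inequality then bound the risk from below by
  \<open>\<Delta>\<^sup>2 / (1 + 3)\<^sup>2\<close>, where \<open>\<Delta>\<close> is the distance of the parameters (\<open>two_point_lower_bound\<close>).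

  The space of observations is an arbitrary measurable space, so the densities of the measures
  \<open>Q\<^sub>x\<close> need not have versions that are jointly measurable in \<open>x\<close> and the observation. For this
  reason the argument uses the \<open>\<chi>\<^sup>2\<close>-divergence in its dual form, as an inequality between
  integrals of test functions.
\<close>

section \<open>The chi-square divergence in dual form\<close>

text \<open>
  By duality in \<open>L\<^sup>2(N)\<close>, for \<open>C \<ge> 0\<close> and finite measures \<open>M\<close> and \<open>N\<close> on the same
  sigma-algebra, this says that \<open>M\<close> has a density \<open>f\<close> with respect to \<open>N\<close> and that
  \<open>\<integral> f\<^sup>2 dN \<le> C\<close>; for probability measures, that \<open>1 + \<chi>\<^sup>2(M \<parallel> N) \<le> C\<close>.
\<close>

definition moment_dominated :: "real \<Rightarrow> 'a measure \<Rightarrow> 'a measure \<Rightarrow> bool" where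
  "moment_dominated C M N \<longleftrightarrow>
     (\<forall>g\<in>borel_measurable N. (\<integral>\<^sup>+ x. g x \<partial>M)\<^sup>2 \<le> ennreal C * (\<integral>\<^sup>+ x. (g x)\<^sup>2 \<partial>N))"

text \<open>
  This is the Cauchy-Schwarz inequality for \<open>\<integral> g dM = \<integral> f g dN\<close>, where \<open>f\<close> is the density of \<open>M\<close>.
\<close>

lemma renyi_div2_le_imp_moment_dominated:
  assumes "prob_space N" and sets_eq: "sets M = sets N"
    and le: "renyi_div2 M N \<le> ereal e" and "0 \<le> e"
  shows "moment_dominated (exp e) M N"
proof -
  interpret N: prob_space N by fact
  define I where "I = (\<integral>\<^sup>+ z. (RN_deriv N M z)\<^sup>2 \<partial>N)"
  have ac: "absolutely_continuous N M" and "I < \<infinity>" and ln_I: "ln (enn2real I) \<le> e"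
    using le by (auto simp: renyi_div2_def Let_def I_def[symmetric] split: if_splits)
  \<comment> \<open>The case distinction is due to \<open>ln 0 = 0\<close>.\<close>
  have "enn2real I \<le> exp e"
  proof (cases "enn2real I = 0")
    case False
    then have "0 < enn2real I"
      using enn2real_nonneg[of I] by linarith
    then show ?thesis
      using ln_I by (metis exp_le_cancel_iff exp_ln)
  qed simp
  then have I_le: "I \<le> ennreal (exp e)"
    using \<open>I < \<infinity>\<close> by (metis ennreal_enn2real ennreal_leI infinity_ennreal_def)
  show ?thesis
    unfolding moment_dominated_def
  proof
    fix g :: "'a \<Rightarrow> ennreal" assume [measurable]: "g \<in> borel_measurable N"
    have "(\<integral>\<^sup>+ x. g x \<partial>M)\<^sup>2 = (\<integral>\<^sup>+ x. RN_deriv N M x * g x \<partial>N)\<^sup>2"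
      by (subst N.RN_deriv_nn_integral[OF ac sets_eq]) auto
    also have "\<dots> \<le> I * (\<integral>\<^sup>+ x. (g x)\<^sup>2 \<partial>N)"
      unfolding I_def by (rule Cauchy_Schwarz_nn_integral) auto
    also have "\<dots> \<le> ennreal (exp e) * (\<integral>\<^sup>+ x. (g x)\<^sup>2 \<partial>N)"
      by (intro mult_right_mono I_le) auto
    finally show "(\<integral>\<^sup>+ x. g x \<partial>M)\<^sup>2 \<le> \<dots>" .
  qed
qed

text \<open>
  The Hammersley-Chapman-Robbins inequality: \<open>\<kappa> - 1\<close> bounds the \<open>\<chi>\<^sup>2\<close>-divergence. Domination
  applied to \<open>\<bar>h - N h + t\<bar>\<close> gives a quadratic inequality in the real number \<open>t\<close>, and the bound
  is the condition on its discriminant.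
\<close>

lemma moment_dominated_imp_expectation_diff_le_variance:
  fixes h :: "'a \<Rightarrow> real"
  assumes "prob_space M" "prob_space N" and sets_eq: "sets M = sets N"
    and dom: "moment_dominated \<kappa> M N" and "1 < \<kappa>"
    and h[measurable]: "h \<in> borel_measurable N" and bound: "\<And>x. \<bar>h x\<bar> \<le> b"
  shows "((\<integral>x. h x \<partial>M) - (\<integral>x. h x \<partial>N))\<^sup>2 \<le> (\<kappa> - 1) * ((\<integral>x. (h x)\<^sup>2 \<partial>N) - (\<integral>x. h x \<partial>N)\<^sup>2)"
proof -
  interpret M: prob_space M by fact
  interpret N: prob_space N by fact
  have hM[measurable]: "h \<in> borel_measurable M"
    using h measurable_cong_sets[OF sets_eq refl] by blast
  have intM: "integrable M h"
    by (rule M.integrable_const_bound[of _ b]) (use bound in auto)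
  have intN: "integrable N h"
    by (rule N.integrable_const_bound[of _ b]) (use bound in auto)
  have intN2: "integrable N (\<lambda>x. (h x)\<^sup>2)"
    by (rule N.integrable_const_bound[of _ "b\<^sup>2"])
       (use bound in \<open>auto intro!: power2_le_iff_abs_le[THEN iffD2] simp: abs_le_square_iff[symmetric] intro: order_trans[OF _ abs_ge_self]\<close>)
  define m V d where "m = (\<integral>x. h x \<partial>N)" and "V = (\<integral>x. (h x)\<^sup>2 \<partial>N) - m\<^sup>2"
    and "d = (\<integral>x. h x \<partial>M) - m"
  have affine: "(d + t)\<^sup>2 \<le> \<kappa> * (V + t\<^sup>2)" for t
  proof -
    define u where "u x = h x + (t - m)" for x
    have [measurable]: "u \<in> borel_measurable M" "u \<in> borel_measurable N"
      unfolding u_def by measurable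
    have u2: "integrable N (\<lambda>x. (u x)\<^sup>2)"
      using intN intN2 by (simp add: u_def power2_sum)
    have "(\<integral>x. (u x)\<^sup>2 \<partial>N) = (\<integral>x. (h x)\<^sup>2 \<partial>N) + (t - m)\<^sup>2 + 2 * m * (t - m)"
      using intN intN2 by (simp add: u_def power2_sum m_def N.prob_space)
    also have "\<dots> = V + t\<^sup>2"
      by (simp add: V_def power2_eq_square algebra_simps)
    finally have second: "(\<integral>x. (u x)\<^sup>2 \<partial>N) = V + t\<^sup>2" .
    have iu: "integrable M u"
      using intM by (simp add: u_def[abs_def])
    have "(\<integral>x. u x \<partial>M) = d + t"
      using intM by (simp add: u_def d_def M.prob_space)
    moreover have "\<bar>\<integral>x. u x \<partial>M\<bar> \<le> (\<integral>x. \<bar>u x\<bar> \<partial>M)"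
      using integral_norm_bound[of M u] by simp
    ultimately have "\<bar>d + t\<bar> \<le> (\<integral>x. \<bar>u x\<bar> \<partial>M)"
      by simp
    then have "(d + t)\<^sup>2 \<le> (\<integral>x. \<bar>u x\<bar> \<partial>M)\<^sup>2"
      by (simp add: power2_le_iff_abs_le)
    also have "\<dots> \<le> \<kappa> * (\<integral>x. (u x)\<^sup>2 \<partial>N)"
    proof -
      have "(\<integral>\<^sup>+x. ennreal \<bar>u x\<bar> \<partial>M)\<^sup>2 \<le> ennreal \<kappa> * (\<integral>\<^sup>+x. (ennreal \<bar>u x\<bar>)\<^sup>2 \<partial>N)"
        using dom unfolding moment_dominated_def by (rule bspec) measurable
      then have "ennreal ((\<integral>x. \<bar>u x\<bar> \<partial>M)\<^sup>2) \<le> ennreal (\<kappa> * (\<integral>x. (u x)\<^sup>2 \<partial>N))"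
        using iu u2 \<open>1 < \<kappa>\<close>
        by (simp add: nn_integral_eq_integral ennreal_power ennreal_mult)
      then show ?thesis
        using \<open>1 < \<kappa>\<close> by (subst (asm) ennreal_le_iff) auto
    qed
    finally show ?thesis unfolding second .
  qed
  \<comment> \<open>The minimiser of the right-hand side minus the left-hand side over \<open>t\<close> is \<open>d / (\<kappa> - 1)\<close>.\<close>
  have "(d + d / (\<kappa> - 1))\<^sup>2 \<le> \<kappa> * (V + (d / (\<kappa> - 1))\<^sup>2)"
    by (rule affine)
  then have scaled: "((\<kappa> - 1) * (d + d / (\<kappa> - 1)))\<^sup>2 \<le> (\<kappa> - 1)\<^sup>2 * (\<kappa> * (V + (d / (\<kappa> - 1))\<^sup>2))"
    unfolding power_mult_distrib by (rule mult_left_mono) auto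
  have lhs: "(\<kappa> - 1) * (d + d / (\<kappa> - 1)) = \<kappa> * d"
    using \<open>1 < \<kappa>\<close> by (simp add: field_simps)
  have rhs: "(\<kappa> - 1)\<^sup>2 * (\<kappa> * (V + (d / (\<kappa> - 1))\<^sup>2)) = \<kappa> * ((\<kappa> - 1)\<^sup>2 * V + d\<^sup>2)"
    using \<open>1 < \<kappa>\<close> by (simp add: field_simps)
  have "\<kappa> * (\<kappa> * d\<^sup>2) \<le> \<kappa> * ((\<kappa> - 1)\<^sup>2 * V + d\<^sup>2)"
    using scaled unfolding lhs rhs by (simp add: power_mult_distrib power2_eq_square[of \<kappa>] mult.assoc)
  then have "\<kappa> * d\<^sup>2 \<le> (\<kappa> - 1)\<^sup>2 * V + d\<^sup>2"
    using \<open>1 < \<kappa>\<close> by simp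
  then have "(\<kappa> - 1) * d\<^sup>2 \<le> (\<kappa> - 1) * ((\<kappa> - 1) * V)"
    by (simp add: power2_eq_square algebra_simps)
  then show ?thesis
    using \<open>1 < \<kappa>\<close> by (simp add: d_def V_def m_def)
qed

text \<open>
  Variances and real differences need bounded test functions, whereas iterating over observations
  is easiest with extended nonnegative ones; truncation and monotone convergence connect the two.
\<close>

lemma moment_dominated_bounded_imp_ennreal:
  assumes "prob_space M" "prob_space N" and sets_eq: "sets M = sets N" and "0 \<le> C"
    and bounded: "\<And>h b. \<lbrakk>h \<in> borel_measurable N; \<And>x. 0 \<le> h x; \<And>x. h x \<le> b\<rbrakk> \<Longrightarrow>
          (\<integral>x. h x \<partial>M)\<^sup>2 \<le> C * (\<integral>x. (h x :: real)\<^sup>2 \<partial>N)"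
  shows "moment_dominated C M N"
  unfolding moment_dominated_def
proof
  fix g :: "'a \<Rightarrow> ennreal" assume g[measurable]: "g \<in> borel_measurable N"
  interpret M: prob_space M by fact
  interpret N: prob_space N by fact
  have gM[measurable]: "g \<in> borel_measurable M"
    using g measurable_cong_sets[OF sets_eq refl] by blast
  define S where "S = ennreal C * (\<integral>\<^sup>+ x. (g x)\<^sup>2 \<partial>N)"
  have "(\<integral>\<^sup>+ x. g x \<partial>M)\<^sup>2 \<le> S"
  proof (cases S)
    case (real r)
    define u where "u k x = enn2real (min (g x) (of_nat k))" for k x
    have fin: "min (g x) (of_nat k) < top" for k x
      by (auto simp: min_def of_nat_less_top le_less_trans)
    then have u: "ennreal (u k x) = min (g x) (of_nat k)" for k x
      by (simp add: u_def)
    have u0: "0 \<le> u k x" for k x by (simp add: u_def)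
    have ule: "u k x \<le> real k" for k x
      unfolding u_def by (rule enn2real_leI) (auto simp: ennreal_of_nat_eq_real_of_nat)
    have [measurable]: "u k \<in> borel_measurable N" "u k \<in> borel_measurable M" for k
      unfolding u_def by measurable
    have trunc: "(\<integral>\<^sup>+ x. min (g x) (of_nat k) \<partial>M) \<le> ennreal (sqrt r)" for k
    proof -
      have iM: "integrable M (u k)"
        by (rule M.integrable_const_bound[of _ "real k"]) (use u0 ule in auto)
      have iN: "integrable N (\<lambda>x. (u k x)\<^sup>2)"
        by (rule N.integrable_const_bound[of _ "(real k)\<^sup>2"]) (use u0 ule in \<open>auto intro!: power_mono\<close>)
      have "ennreal (C * (\<integral>x. (u k x)\<^sup>2 \<partial>N)) = ennreal C * (\<integral>\<^sup>+ x. (ennreal (u k x))\<^sup>2 \<partial>N)"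
        using iN \<open>0 \<le> C\<close> u0 by (simp add: nn_integral_eq_integral ennreal_power ennreal_mult)
      also have "\<dots> \<le> S"
        unfolding S_def u by (intro mult_left_mono nn_integral_mono power_mono) auto
      finally have "C * (\<integral>x. (u k x)\<^sup>2 \<partial>N) \<le> r"
        using real by simp
      with bounded[of "u k" "real k"] u0 ule have "(\<integral>x. u k x \<partial>M)\<^sup>2 \<le> r"
        by force
      then have "(\<integral>x. u k x \<partial>M) \<le> sqrt r"
        by (rule real_le_rsqrt)
      moreover have "(\<integral>\<^sup>+ x. min (g x) (of_nat k) \<partial>M) = ennreal (\<integral>x. u k x \<partial>M)"
        using iM u0 by (simp flip: u add: nn_integral_eq_integral)
      ultimately show ?thesis
        by (simp add: ennreal_leI)
    qed
    have "(\<integral>\<^sup>+ x. g x \<partial>M) = (\<integral>\<^sup>+ x. (SUP k. min (g x) (of_nat k)) \<partial>M)"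
      by (simp flip: inf_min inf_SUP add: ennreal_SUP_of_nat_eq_top)
    also have "\<dots> = (SUP k. \<integral>\<^sup>+ x. min (g x) (of_nat k) \<partial>M)"
      by (rule nn_integral_monotone_convergence_SUP)
         (auto simp: incseq_def le_fun_def intro: min.coboundedI2)
    also have "\<dots> \<le> ennreal (sqrt r)"
      by (rule SUP_least) (rule trunc)
    finally have "(\<integral>\<^sup>+ x. g x \<partial>M)\<^sup>2 \<le> (ennreal (sqrt r))\<^sup>2"
      by (rule power_mono) simp
    then show ?thesis
      using real by (simp add: ennreal_power)
  qed simp
  then show "(\<integral>\<^sup>+ x. g x \<partial>M)\<^sup>2 \<le> ennreal C * (\<integral>\<^sup>+ x. (g x)\<^sup>2 \<partial>N)"
    unfolding S_def .
qed

text \<open>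
  The converse of \<open>moment_dominated_imp_expectation_diff_le_variance\<close>. With mean \<open>m\<close> and variance
  \<open>V\<close> under \<open>N\<close>, the mean under \<open>M\<close> is at most \<open>\<bar>m\<bar> + sqrt c sqrt V\<close> in absolute value, and the
  Cauchy-Schwarz inequality in the plane bounds its square by \<open>(1 + c) (m\<^sup>2 + V)\<close>.
\<close>

lemma variance_bound_imp_moment_dominated:
  assumes "prob_space M" "prob_space N" and sets_eq: "sets M = sets N" and "0 \<le> c"
    and var: "\<And>h b. \<lbrakk>h \<in> borel_measurable N; \<And>x. \<bar>h x\<bar> \<le> b\<rbrakk> \<Longrightarrow>
          ((\<integral>x. h x \<partial>M) - (\<integral>x. h x \<partial>N))\<^sup>2
            \<le> c * ((\<integral>x. (h x :: real)\<^sup>2 \<partial>N) - (\<integral>x. h x \<partial>N)\<^sup>2)"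
  shows "moment_dominated (1 + c) M N"
proof (rule moment_dominated_bounded_imp_ennreal[OF assms(1-3)])
  fix h :: "'a \<Rightarrow> real" and b
  assume h[measurable]: "h \<in> borel_measurable N" and h0: "\<And>x. 0 \<le> h x" and hb: "\<And>x. h x \<le> b"
  interpret N: prob_space N by fact
  define m V d where "m = (\<integral>x. h x \<partial>N)" and "V = (\<integral>x. (h x)\<^sup>2 \<partial>N) - m\<^sup>2"
    and "d = (\<integral>x. h x \<partial>M) - m"
  have d: "d\<^sup>2 \<le> c * V"
    using var[of h b] h0 hb by (simp add: d_def V_def m_def)
  have "integrable N h"
    by (rule N.integrable_const_bound[of _ b]) (use h0 hb in auto)
  moreover have "integrable N (\<lambda>x. (h x)\<^sup>2)"
    by (rule N.integrable_const_bound[of _ "b\<^sup>2"]) (use h0 hb in \<open>auto intro!: power_mono\<close>)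
  ultimately have "0 \<le> V"
    using N.variance_positive[of h] by (simp add: N.variance_eq V_def m_def)
  have "(m + d)\<^sup>2 \<le> (1 + c) * (V + m\<^sup>2)"
  proof (cases "c = 0")
    case True
    with d \<open>0 \<le> V\<close> show ?thesis by simp
  next
    case False
    then have "0 < c" using \<open>0 \<le> c\<close> by simp
    have "0 \<le> (c * m - d)\<^sup>2" by simp
    also have "\<dots> \<le> c * (c * m\<^sup>2 + V - 2 * m * d)"
      using d by (simp add: power2_eq_square algebra_simps)
    finally have "0 \<le> c * m\<^sup>2 + V - 2 * m * d"
      using \<open>0 < c\<close> by (simp add: zero_le_mult_iff)
    then show ?thesis
      using d by (simp add: power2_eq_square algebra_simps)
  qed
  then show "(\<integral>x. h x \<partial>M)\<^sup>2 \<le> (1 + c) * (\<integral>x. (h x)\<^sup>2 \<partial>N)"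
    by (simp add: d_def V_def)
qed (use \<open>0 \<le> c\<close> in simp)

section \<open>Total variation and integrals of bounded functions\<close>

lemma measure_diff_le_tv_dist:
  assumes "prob_space P" "prob_space Q" "A \<in> sets P"
  shows "\<bar>measure P A - measure Q A\<bar> \<le> tv_dist P Q"
  unfolding tv_dist_def
proof (rule cSUP_upper)
  interpret P: prob_space P by fact
  interpret Q: prob_space Q by fact
  show "bdd_above ((\<lambda>A. \<bar>measure P A - measure Q A\<bar>) ` sets P)"
  proof (rule bdd_aboveI2)
    fix A show "\<bar>measure P A - measure Q A\<bar> \<le> 1"
      using P.prob_le_1[of A] Q.prob_le_1[of A] measure_nonneg[of P A] measure_nonneg[of Q A]
      by linarith
  qed
qed fact

text \<open>
  This expresses an integral through the measures of the superlevel sets, the only quantities that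
  the total variation distance controls directly.
\<close>

lemma nn_integral_layer_cake:
  fixes \<phi> :: "'a \<Rightarrow> real"
  assumes "sigma_finite_measure P" and [measurable]: "\<phi> \<in> borel_measurable P"
    and "\<And>x. x \<in> space P \<Longrightarrow> \<phi> x \<le> b"
  shows "(\<integral>\<^sup>+ x. ennreal (\<phi> x) \<partial>P) =
         (\<integral>\<^sup>+ t. indicator {0..b} t * emeasure P {x \<in> space P. t < \<phi> x} \<partial>lborel)"
proof -
  interpret sigma_finite_measure P by fact
  interpret pair_sigma_finite P lborel ..
  have "(\<integral>\<^sup>+ x. ennreal (\<phi> x) \<partial>P) =
        (\<integral>\<^sup>+ x. \<integral>\<^sup>+ t. indicator {0..b} t * indicator {x \<in> space P. t < \<phi> x} x \<partial>lborel \<partial>P)"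
  proof (rule nn_integral_cong)
    fix x assume x: "x \<in> space P"
    have "ennreal (\<phi> x) = emeasure lborel {0..<\<phi> x}"
      by (cases "0 \<le> \<phi> x") (auto simp: ennreal_neg)
    also have "\<dots> = (\<integral>\<^sup>+ t. indicator {0..<\<phi> x} t \<partial>lborel)"
      by simp
    also have "\<dots> = (\<integral>\<^sup>+ t. indicator {0..b} t * indicator {x \<in> space P. t < \<phi> x} x \<partial>lborel)"
      using x assms(3)[OF x] by (intro nn_integral_cong) (auto simp: indicator_def)
    finally show "ennreal (\<phi> x) = \<dots>" .
  qed
  also have "\<dots> = (\<integral>\<^sup>+ t. \<integral>\<^sup>+ x. indicator {0..b} t * indicator {x \<in> space P. t < \<phi> x} x \<partial>P \<partial>lborel)"
    by (rule Fubini'[symmetric]) measurable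
  also have "\<dots> = (\<integral>\<^sup>+ t. indicator {0..b} t * emeasure P {x \<in> space P. t < \<phi> x} \<partial>lborel)"
    by (intro nn_integral_cong) (simp add: nn_integral_cmult)
  finally show ?thesis .
qed

lemma integral_diff_le_tv_dist:
  fixes \<phi> :: "'a \<Rightarrow> real"
  assumes "prob_space P" "prob_space Q" and sets_eq: "sets P = sets Q"
    and \<phi>[measurable]: "\<phi> \<in> borel_measurable P"
    and bounds: "\<And>x. x \<in> space P \<Longrightarrow> 0 \<le> \<phi> x" "\<And>x. x \<in> space P \<Longrightarrow> \<phi> x \<le> b" and "0 \<le> b"
  shows "\<bar>(\<integral>x. \<phi> x \<partial>P) - (\<integral>x. \<phi> x \<partial>Q)\<bar> \<le> b * tv_dist P Q"
proof -
  have one_sided: "(\<integral>x. \<phi> x \<partial>M) \<le> (\<integral>x. \<phi> x \<partial>N) + b * tv_dist P Q"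
    if MN: "prob_space M" "prob_space N" and sM: "sets M = sets P" and sN: "sets N = sets P"
      and diff: "\<And>A. A \<in> sets P \<Longrightarrow> measure M A - measure N A \<le> tv_dist P Q" for M N
  proof -
    interpret M: prob_space M by fact
    interpret N: prob_space N by fact
    have [measurable]: "\<phi> \<in> borel_measurable M" "\<phi> \<in> borel_measurable N"
      using \<phi> measurable_cong_sets[OF sM refl] measurable_cong_sets[OF sN refl] by blast+
    have spM: "space M = space P" and spN: "space N = space P"
      using sM sN by (auto dest: sets_eq_imp_space_eq)
    have tv0: "0 \<le> tv_dist P Q"
      using diff[of "{}"] by simp
    have iM: "integrable M \<phi>" and iN: "integrable N \<phi>"
      by (auto intro!: M.integrable_const_bound[of _ b] N.integrable_const_bound[of _ b] AE_I2
               simp: bounds spM spN)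
    have nnM: "(\<integral>\<^sup>+ x. ennreal (\<phi> x) \<partial>M) = ennreal (\<integral>x. \<phi> x \<partial>M)"
      by (rule nn_integral_eq_integral[OF iM]) (auto intro!: AE_I2 simp: bounds spM)
    have nnN: "(\<integral>\<^sup>+ x. ennreal (\<phi> x) \<partial>N) = ennreal (\<integral>x. \<phi> x \<partial>N)"
      by (rule nn_integral_eq_integral[OF iN]) (auto intro!: AE_I2 simp: bounds spN)
    have EN0: "0 \<le> (\<integral>x. \<phi> x \<partial>N)"
      by (rule integral_nonneg_AE) (auto intro!: AE_I2 simp: bounds spN)
    have meas: "{x \<in> space P. t < \<phi> x} \<in> sets P" for t
      by measurable
    have meas_pred: "(\<lambda>t. emeasure N {x \<in> space P. t < \<phi> x}) \<in> borel_measurable lborel"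
      unfolding spN[symmetric] by measurable
    have "ennreal (\<integral>x. \<phi> x \<partial>M) =
          (\<integral>\<^sup>+ t. indicator {0..b} t * emeasure M {x \<in> space P. t < \<phi> x} \<partial>lborel)"
      using nn_integral_layer_cake[OF M.sigma_finite_measure_axioms, of \<phi> b] bounds
      by (simp add: nnM spM)
    also have "\<dots> \<le> (\<integral>\<^sup>+ t. indicator {0..b} t * emeasure N {x \<in> space P. t < \<phi> x}
                        + ennreal (tv_dist P Q) * indicator {0..b} t \<partial>lborel)"
    proof (rule nn_integral_mono)
      fix t :: real
      have "emeasure M {x \<in> space P. t < \<phi> x} \<le> emeasure N {x \<in> space P. t < \<phi> x} + ennreal (tv_dist P Q)"
        using diff[OF meas[of t]] tv0
        by (simp add: M.emeasure_eq_measure N.emeasure_eq_measure ennreal_leI flip: ennreal_plus)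
      then show "indicator {0..b} t * emeasure M {x \<in> space P. t < \<phi> x} \<le>
            indicator {0..b} t * emeasure N {x \<in> space P. t < \<phi> x} + ennreal (tv_dist P Q) * indicator {0..b} t"
        by (auto simp: indicator_def)
    qed
    also have "\<dots> = (\<integral>\<^sup>+ t. indicator {0..b} t * emeasure N {x \<in> space P. t < \<phi> x} \<partial>lborel)
                    + ennreal (tv_dist P Q) * ennreal b"
      using meas_pred \<open>0 \<le> b\<close> by (subst nn_integral_add) (auto simp: nn_integral_cmult_indicator)
    also have "\<dots> = ennreal ((\<integral>x. \<phi> x \<partial>N) + b * tv_dist P Q)"
      using nn_integral_layer_cake[OF N.sigma_finite_measure_axioms, of \<phi> b] bounds EN0 tv0 \<open>0 \<le> b\<close>
      by (simp add: nnN spN ennreal_mult ennreal_plus mult.commute)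
    finally show ?thesis
      using tv0 \<open>0 \<le> b\<close> EN0 by (subst (asm) ennreal_le_iff) auto
  qed
  have "\<bar>measure P A - measure Q A\<bar> \<le> tv_dist P Q" if "A \<in> sets P" for A
    by (rule measure_diff_le_tv_dist[OF assms(1,2) that])
  then have "(\<integral>x. \<phi> x \<partial>P) \<le> (\<integral>x. \<phi> x \<partial>Q) + b * tv_dist P Q"
    "(\<integral>x. \<phi> x \<partial>Q) \<le> (\<integral>x. \<phi> x \<partial>P) + b * tv_dist P Q"
    using assms(1,2) sets_eq by (intro one_sided; force simp: abs_le_iff)+
  then show ?thesis by linarith
qed

section \<open>One private observation\<close>

lemma integral_bind_bounded:
  fixes h :: "'b \<Rightarrow> real"
  assumes "P \<in> space (prob_algebra X)" and "K \<in> X \<rightarrow>\<^sub>M prob_algebra Z"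
    and "h \<in> borel_measurable Z" and "\<And>z. \<bar>h z\<bar> \<le> b"
  shows "(\<integral>z. h z \<partial>(P \<bind> K)) = (\<integral>x. (\<integral>z. h z \<partial>K x) \<partial>P)"
proof -
  have P: "prob_space P" "sets P = sets X"
    using assms(1) by (auto simp: space_prob_algebra)
  interpret P: prob_space P by fact
  have K: "K \<in> P \<rightarrow>\<^sub>M subprob_algebra Z"
    using measurable_prob_algebraD[OF assms(2)] measurable_cong_sets[OF P(2) refl] by blast
  show ?thesis
    by (rule integral_bind[where B=b and B'=1])
       (use assms K P.not_empty in \<open>auto simp: P.emeasure_space_1 intro: P.finite_measure_axioms
          dest: subprob_measurableD(1) subprob_space.subprob_emeasure_le_1[OF subprob_space_kernel]\<close>)
qed

text \<open>
  The contraction for one observation. The conditional mean \<open>\<phi> x\<close> of \<open>h\<close> given the datum deviates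
  from its average \<open>m\<close> under \<open>P'\<close> by at most \<open>B = sqrt ((\<kappa> - 1) V)\<close>, where \<open>V\<close> is the variance of
  \<open>h\<close> under the mixture: Jensen's inequality passes from \<open>m\<close> to the values \<open>\<phi> x'\<close>, domination
  bounds \<open>(\<phi> x - \<phi> x')\<^sup>2\<close> by \<open>\<kappa> - 1\<close> times the variance of \<open>h\<close> given \<open>x'\<close>, and the mean of these
  conditional variances is at most \<open>V\<close>. Total variation then acts on a function with values in an
  interval of length \<open>2 B\<close>.
\<close>

lemma moment_dominated_kernel_mixture:
  fixes K :: "'x \<Rightarrow> 'z measure"
  assumes P: "P \<in> space (prob_algebra X)" and P': "P' \<in> space (prob_algebra X)"
    and K: "K \<in> X \<rightarrow>\<^sub>M prob_algebra Z"
    and dom: "\<And>x x'. x \<in> space X \<Longrightarrow> x' \<in> space X \<Longrightarrow> moment_dominated \<kappa> (K x) (K x')"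
    and "1 < \<kappa>" and tv: "tv_dist P P' \<le> \<delta>"
  shows "moment_dominated (1 + 4 * \<delta>\<^sup>2 * (\<kappa> - 1)) (P \<bind> K) (P' \<bind> K)"
proof (rule variance_bound_imp_moment_dominated)
  show "prob_space (P \<bind> K)" "prob_space (P' \<bind> K)"
    using prob_space_bind' P P' K by blast+
  have sets_bind: "sets (P \<bind> K) = sets Z" "sets (P' \<bind> K) = sets Z"
    using sets_bind' P P' K by blast+
  then show "sets (P \<bind> K) = sets (P' \<bind> K)" by simp
  show "0 \<le> 4 * \<delta>\<^sup>2 * (\<kappa> - 1)"
    using \<open>1 < \<kappa>\<close> by simp
  fix h :: "'z \<Rightarrow> real" and b
  assume "h \<in> borel_measurable (P' \<bind> K)" and b: "\<And>z. \<bar>h z\<bar> \<le> b"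
  then have h[measurable]: "h \<in> borel_measurable Z"
    using measurable_cong_sets[OF sets_bind(2) refl] by blast
  have b2: "\<bar>(h z)\<^sup>2\<bar> \<le> b\<^sup>2" for z
    using power_mono[OF b[of z], of 2] by simp
  have pP: "prob_space P" "sets P = sets X" and pP': "prob_space P'" "sets P' = sets X"
    using P P' by (auto simp: space_prob_algebra)
  interpret P: prob_space P by fact
  interpret P': prob_space P' by fact
  have spX: "space P = space X" "space P' = space X"
    using pP(2) pP'(2) by (auto dest: sets_eq_imp_space_eq)
  have Kx: "prob_space (K x)" "sets (K x) = sets Z" if "x \<in> space X" for x
    using measurable_space[OF K that] by (auto simp: space_prob_algebra)
  define \<phi> \<psi> where "\<phi> x = (\<integral>z. h z \<partial>K x)" and "\<psi> x = (\<integral>z. (h z)\<^sup>2 \<partial>K x)" for x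
  have K': "K \<in> X \<rightarrow>\<^sub>M subprob_algebra Z"
    by (rule measurable_prob_algebraD[OF K])
  have \<phi>X: "\<phi> \<in> borel_measurable X" and \<psi>X: "\<psi> \<in> borel_measurable X"
    unfolding \<phi>_def \<psi>_def
    by (rule measurable_compose[OF K' integral_measurable_subprob_algebra]; measurable)+
  have [measurable]: "\<phi> \<in> borel_measurable P" "\<phi> \<in> borel_measurable P'" "\<psi> \<in> borel_measurable P'"
    using \<phi>X \<psi>X measurable_cong_sets[OF pP(2) refl] measurable_cong_sets[OF pP'(2) refl] by blast+
  have \<phi>b: "\<bar>\<phi> x\<bar> \<le> b" and \<psi>b: "\<bar>\<psi> x\<bar> \<le> b\<^sup>2" if "x \<in> space X" for x
  proof -
    interpret Kx: prob_space "K x" by (rule Kx(1)[OF that])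
    have [measurable]: "h \<in> borel_measurable (K x)"
      using h measurable_cong_sets[OF Kx(2)[OF that] refl] by blast
    have bnd: "\<bar>\<integral>z. f z \<partial>K x\<bar> \<le> c" if "f \<in> borel_measurable (K x)" "\<And>z. \<bar>f z\<bar> \<le> c" for f and c :: real
    proof -
      have "integrable (K x) f"
        by (rule Kx.integrable_const_bound[of _ c]) (use that in auto)
      then have "(\<integral>z. \<bar>f z\<bar> \<partial>K x) \<le> c"
        by (intro Kx.integral_le_const) (use that in auto)
      then show ?thesis
        using integral_abs_bound[of "K x" f] by linarith
    qed
    show "\<bar>\<phi> x\<bar> \<le> b" "\<bar>\<psi> x\<bar> \<le> b\<^sup>2"
      unfolding \<phi>_def \<psi>_def by (intro bnd b b2; measurable)+
  qed
  have i\<phi>: "integrable P \<phi>"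
    by (rule P.integrable_const_bound[of _ b]) (auto intro!: AE_I2 simp: spX \<phi>b)
  have i\<phi>': "integrable P' \<phi>"
    by (rule P'.integrable_const_bound[of _ b]) (auto intro!: AE_I2 simp: spX \<phi>b)
  have i\<psi>': "integrable P' \<psi>"
    by (rule P'.integrable_const_bound[of _ "b\<^sup>2"]) (auto intro!: AE_I2 simp: spX \<psi>b)
  have i\<phi>2': "integrable P' (\<lambda>x. (\<phi> x)\<^sup>2)"
  proof (rule P'.integrable_const_bound[of _ "b\<^sup>2"])
    show "AE x in P'. norm ((\<phi> x)\<^sup>2) \<le> b\<^sup>2"
      using power_mono[OF \<phi>b, of _ 2] by (auto intro!: AE_I2 simp: spX)
  qed measurable
  have E0: "(\<integral>z. h z \<partial>(P \<bind> K)) = (\<integral>x. \<phi> x \<partial>P)"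
    unfolding \<phi>_def by (rule integral_bind_bounded[OF P K h b])
  have E1: "(\<integral>z. h z \<partial>(P' \<bind> K)) = (\<integral>x. \<phi> x \<partial>P')"
    unfolding \<phi>_def by (rule integral_bind_bounded[OF P' K h b])
  have E2: "(\<integral>z. (h z)\<^sup>2 \<partial>(P' \<bind> K)) = (\<integral>x. \<psi> x \<partial>P')"
    unfolding \<psi>_def by (rule integral_bind_bounded[OF P' K _ b2]) measurable
  define m V where "m = (\<integral>x. \<phi> x \<partial>P')" and "V = (\<integral>x. \<psi> x \<partial>P') - m\<^sup>2"
  have dev: "(\<phi> x - m)\<^sup>2 \<le> (\<kappa> - 1) * V" if x: "x \<in> space X" for x
  proof -
    have isq: "integrable P' (\<lambda>x'. (\<phi> x - \<phi> x')\<^sup>2)"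
      using i\<phi>' i\<phi>2' by (simp add: power2_diff)
    have "(\<phi> x - m)\<^sup>2 = (\<integral>x'. \<phi> x - \<phi> x' \<partial>P')\<^sup>2"
      using i\<phi>' by (simp add: m_def P'.prob_space)
    also have "\<dots> \<le> (\<integral>x'. (\<phi> x - \<phi> x')\<^sup>2 \<partial>P')"
      using P'.variance_positive[of "\<lambda>x'. \<phi> x - \<phi> x'"] isq i\<phi>'
      by (subst (asm) P'.variance_eq) auto
    also have "\<dots> \<le> (\<integral>x'. (\<kappa> - 1) * (\<psi> x' - (\<phi> x')\<^sup>2) \<partial>P')"
    proof (rule integral_mono[OF isq])
      show "integrable P' (\<lambda>x'. (\<kappa> - 1) * (\<psi> x' - (\<phi> x')\<^sup>2))"
        using i\<psi>' i\<phi>2' by simp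
      fix x' assume "x' \<in> space P'"
      then have x': "x' \<in> space X" by (simp add: spX)
      show "(\<phi> x - \<phi> x')\<^sup>2 \<le> (\<kappa> - 1) * (\<psi> x' - (\<phi> x')\<^sup>2)"
        unfolding \<phi>_def \<psi>_def
      proof (rule moment_dominated_imp_expectation_diff_le_variance[OF _ _ _ dom[OF x x']])
        show "h \<in> borel_measurable (K x')"
          using h measurable_cong_sets[OF Kx(2)[OF x'] refl] by blast
      qed (use Kx x x' \<open>1 < \<kappa>\<close> b in auto)
    qed
    also have "\<dots> = (\<kappa> - 1) * ((\<integral>x. \<psi> x \<partial>P') - (\<integral>x. (\<phi> x)\<^sup>2 \<partial>P'))"
      using i\<psi>' i\<phi>2' by simp
    also have "\<dots> \<le> (\<kappa> - 1) * V"
      using P'.variance_positive[of \<phi>] i\<phi>' i\<phi>2' \<open>1 < \<kappa>\<close>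
      by (intro mult_left_mono) (auto simp: P'.variance_eq V_def m_def)
    finally show ?thesis .
  qed
  obtain x0 where "x0 \<in> space X"
    using P.not_empty spX by auto
  then have W0: "0 \<le> (\<kappa> - 1) * V"
    using dev[of x0] zero_le_power2 order_trans by blast
  define B where "B = sqrt ((\<kappa> - 1) * V)"
  have B2: "B\<^sup>2 = (\<kappa> - 1) * V" and "0 \<le> B"
    using W0 by (auto simp: B_def)
  have devB: "\<bar>\<phi> x - m\<bar> \<le> B" if "x \<in> space X" for x
    using dev[OF that] by (simp add: B_def real_le_rsqrt)
  \<comment> \<open>Adding \<open>B\<close> moves the values of \<open>\<phi> - m\<close> from \<open>[-B, B]\<close> to \<open>[0, 2 B]\<close>.\<close>
  have "\<bar>(\<integral>x. \<phi> x - m + B \<partial>P) - (\<integral>x. \<phi> x - m + B \<partial>P')\<bar> \<le> 2 * B * tv_dist P P'"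
  proof (rule integral_diff_le_tv_dist[OF pP(1) pP'(1)])
    fix x assume "x \<in> space P"
    with devB[of x] show "0 \<le> \<phi> x - m + B" "\<phi> x - m + B \<le> 2 * B"
      by (auto simp: spX abs_le_iff)
  qed (use pP(2) pP'(2) \<open>0 \<le> B\<close> in auto)
  also have "\<dots> \<le> 2 * B * \<delta>"
    using tv \<open>0 \<le> B\<close> by (intro mult_left_mono) auto
  finally have "\<bar>(\<integral>x. \<phi> x \<partial>P) - m\<bar> \<le> 2 * B * \<delta>"
    using i\<phi> i\<phi>' by (simp add: P.prob_space P'.prob_space m_def)
  then have "((\<integral>x. \<phi> x \<partial>P) - m)\<^sup>2 \<le> (2 * B * \<delta>)\<^sup>2"
    using power_mono[of "\<bar>(\<integral>x. \<phi> x \<partial>P) - m\<bar>" _ 2] by simp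
  also have "\<dots> = 4 * \<delta>\<^sup>2 * (\<kappa> - 1) * V"
    by (simp add: power_mult_distrib B2)
  finally show "((\<integral>z. h z \<partial>(P \<bind> K)) - (\<integral>z. h z \<partial>(P' \<bind> K)))\<^sup>2 \<le> 4 * \<delta>\<^sup>2 * (\<kappa> - 1) *
       ((\<integral>z. (h z)\<^sup>2 \<partial>(P' \<bind> K)) - (\<integral>z. h z \<partial>(P' \<bind> K))\<^sup>2)"
    unfolding E0 E1 E2 V_def m_def .
qed

section \<open>The law of the private observations\<close>

lemma measurable_append_observation:
  "(\<lambda>(z, w). z(i := w)) \<in> PiM {..<i} (\<lambda>_. Z) \<Otimes>\<^sub>M Z \<rightarrow>\<^sub>M PiM {..<Suc i} (\<lambda>_. Z)"
  unfolding lessThan_Suc by (rule measurable_add_dim)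

lemma measurable_private_law_given_step:
  assumes Q: "Q \<in> seq_channels X Z n" and "i < n" "i \<in> I"
  shows "(\<lambda>(x, z). distr (Q i (x i, z)) (PiM {..<Suc i} (\<lambda>_. Z)) (\<lambda>w. z(i := w)))
     \<in> PiM I (\<lambda>_. X) \<Otimes>\<^sub>M PiM {..<i} (\<lambda>_. Z) \<rightarrow>\<^sub>M prob_algebra (PiM {..<Suc i} (\<lambda>_. Z))"
proof -
  have [measurable]: "Q i \<in> X \<Otimes>\<^sub>M PiM {..<i} (\<lambda>_. Z) \<rightarrow>\<^sub>M prob_algebra Z"
    using Q \<open>i < n\<close> by (auto simp: seq_channels_def)
  note measurable_append_observation[of i Z, measurable]
  have [measurable]: "(\<lambda>p. fst p i) \<in> PiM I (\<lambda>_. X) \<Otimes>\<^sub>M PiM {..<i} (\<lambda>_. Z) \<rightarrow>\<^sub>M X"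
    using \<open>i \<in> I\<close> by measurable
  have "(\<lambda>p. distr (Q i (fst p i, snd p)) (PiM {..<Suc i} (\<lambda>_. Z)) (\<lambda>w. (snd p)(i := w)))
     \<in> PiM I (\<lambda>_. X) \<Otimes>\<^sub>M PiM {..<i} (\<lambda>_. Z) \<rightarrow>\<^sub>M prob_algebra (PiM {..<Suc i} (\<lambda>_. Z))"
  proof (rule measurable_distr_prob_space2)
    show "(\<lambda>p. Q i (fst p i, snd p)) \<in> PiM I (\<lambda>_. X) \<Otimes>\<^sub>M PiM {..<i} (\<lambda>_. Z) \<rightarrow>\<^sub>M prob_algebra Z"
      by measurable
    show "(\<lambda>(p, w). (snd p)(i := w)) \<in>
       (PiM I (\<lambda>_. X) \<Otimes>\<^sub>M PiM {..<i} (\<lambda>_. Z)) \<Otimes>\<^sub>M Z \<rightarrow>\<^sub>M PiM {..<Suc i} (\<lambda>_. Z)"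
      using measurable_compose[of "\<lambda>(p, w). (snd p, w)" "(PiM I (\<lambda>_. X) \<Otimes>\<^sub>M PiM {..<i} (\<lambda>_. Z)) \<Otimes>\<^sub>M Z"
          "PiM {..<i} (\<lambda>_. Z) \<Otimes>\<^sub>M Z", OF _ measurable_append_observation[of i Z]]
      by (simp add: case_prod_beta')
  qed
  then show ?thesis
    by (simp add: case_prod_beta')
qed

text \<open>
  The index set \<open>I\<close> of the data may exceed \<open>{..<i}\<close>: the first \<open>i\<close> observations are also
  integrated against data sequences that already contain the datum with index \<open>i\<close>.
\<close>

lemma measurable_private_law_given:
  assumes Q: "Q \<in> seq_channels X Z n" and "i \<le> n" "{..<i} \<subseteq> I"
  shows "(\<lambda>x. private_law_given Z Q x i) \<in> PiM I (\<lambda>_. X) \<rightarrow>\<^sub>M prob_algebra (PiM {..<i} (\<lambda>_. Z))"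
  using assms(2,3)
proof (induction i)
  case 0
  have "return (PiM {..<0 :: nat} (\<lambda>_. Z)) (\<lambda>_. undefined) \<in> space (prob_algebra (PiM {..<0} (\<lambda>_. Z)))"
    by (rule measurable_space[OF measurable_return_prob_space]) (simp add: space_PiM PiE_def)
  then show ?case
    by simp
next
  case (Suc i)
  then have [measurable]: "(\<lambda>x. private_law_given Z Q x i) \<in> PiM I (\<lambda>_. X) \<rightarrow>\<^sub>M prob_algebra (PiM {..<i} (\<lambda>_. Z))"
    by (auto simp: lessThan_Suc)
  show ?case
    unfolding private_law_given.simps
    by (rule measurable_bind_prob_space2[where N="PiM {..<i} (\<lambda>_. Z)"])
       (use Suc.prems measurable_private_law_given_step[OF Q, of i I] in auto)
qed

lemma private_law_given_cong:
  assumes "\<And>j. j < i \<Longrightarrow> x j = y j"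
  shows "private_law_given Z Q x i = private_law_given Z Q y i"
  using assms by (induction i) auto

lemma private_law_in_prob_algebra:
  assumes Q: "Q \<in> seq_channels X Z n" and "i \<le> n" and P: "P \<in> space (prob_algebra X)"
  shows "private_law Z Q P i \<in> space (prob_algebra (PiM {..<i} (\<lambda>_. Z)))"
proof -
  have "prob_space P" "sets P = sets X"
    using P by (auto simp: space_prob_algebra)
  then have law: "PiM {..<i} (\<lambda>_. P) \<in> space (prob_algebra (PiM {..<i} (\<lambda>_. X)))"
    by (auto simp: space_prob_algebra prob_space_PiM cong: sets_PiM_cong)
  note kernel = measurable_private_law_given[OF Q \<open>i \<le> n\<close> order_refl]
  show ?thesis
    using prob_space_bind'[OF law kernel] sets_bind'[OF law kernel]
    by (simp add: private_law_def space_prob_algebra)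
qed

text \<open>
  Integrating the data out makes the sequence of observations a process with transition
  kernels \<open>z \<mapsto> P \<bind> (\<lambda>x. Q i (x, z))\<close>: the datum with index \<open>i\<close> is independent of the earlier
  data, hence of the history, so by Fubini's theorem it can be integrated with the history held
  fixed.
\<close>

lemma nn_integral_private_law_Suc:
  assumes Q: "Q \<in> seq_channels X Z n" and "i < n" and P: "P \<in> space (prob_algebra X)"
    and g: "g \<in> borel_measurable (PiM {..<Suc i} (\<lambda>_. Z))"
  shows "(\<integral>\<^sup>+ z. g z \<partial>private_law Z Q P (Suc i)) =
         (\<integral>\<^sup>+ z. \<integral>\<^sup>+ w. g (z(i := w)) \<partial>(P \<bind> (\<lambda>x. Q i (x, z))) \<partial>private_law Z Q P i)"
proof -
  have pP: "prob_space P" and sets_P[measurable_cong]: "sets P = sets X"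
    using P by (auto simp: space_prob_algebra)
  interpret P: prob_space P by fact
  interpret PP: product_prob_space "\<lambda>_. P" UNIV ..
  have sets_PiP: "sets (PiM I (\<lambda>_. P)) = sets (PiM I (\<lambda>_. X))" for I :: "nat set"
    by (auto simp: sets_P cong: sets_PiM_cong)
  have spP: "space P = space X"
    using sets_P by (rule sets_eq_imp_space_eq)
  have Qi[measurable]: "Q i \<in> X \<Otimes>\<^sub>M PiM {..<i} (\<lambda>_. Z) \<rightarrow>\<^sub>M prob_algebra Z"
    using Q \<open>i < n\<close> by (auto simp: seq_channels_def)
  have Qi'[measurable]: "Q i \<in> X \<Otimes>\<^sub>M PiM {..<i} (\<lambda>_. Z) \<rightarrow>\<^sub>M subprob_algebra Z"
    by (rule measurable_prob_algebraD[OF Qi])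
  note [measurable] = g
  define G where "G y z = (\<integral>\<^sup>+ w. g (z(i := w)) \<partial>Q i (y, z))" for y z
  have app: "(\<lambda>w. g (z(i := w))) \<in> borel_measurable Z" if "z \<in> space (PiM {..<i} (\<lambda>_. Z))" for z
    using measurable_compose[OF measurable_Pair1'[OF that] measurable_compose[OF measurable_append_observation g]]
    by simp
  have G_meas: "(\<lambda>(y, z). G y z) \<in> borel_measurable (X \<Otimes>\<^sub>M PiM {..<i} (\<lambda>_. Z))"
  proof -
    have "(\<lambda>p. \<integral>\<^sup>+ w. g ((snd p)(i := w)) \<partial>Q i p) \<in> borel_measurable (X \<Otimes>\<^sub>M PiM {..<i} (\<lambda>_. Z))"
    proof (rule nn_integral_measurable_subprob_algebra2[OF _ Qi'])
      have "(\<lambda>(p, w). (snd p, w)) \<in> (X \<Otimes>\<^sub>M PiM {..<i} (\<lambda>_. Z)) \<Otimes>\<^sub>M Z \<rightarrow>\<^sub>M PiM {..<i} (\<lambda>_. Z) \<Otimes>\<^sub>M Z"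
        by measurable
      from measurable_compose[OF this measurable_compose[OF measurable_append_observation g]]
      show "(\<lambda>(p, w). g ((snd p)(i := w))) \<in> borel_measurable ((X \<Otimes>\<^sub>M PiM {..<i} (\<lambda>_. Z)) \<Otimes>\<^sub>M Z)"
        by (simp add: case_prod_beta')
    qed
    then show ?thesis by (simp add: G_def case_prod_beta')
  qed
  define D where "D x = private_law_given Z Q x i" for x
  have D: "(\<lambda>x. D x) \<in> PiM I (\<lambda>_. P) \<rightarrow>\<^sub>M prob_algebra (PiM {..<i} (\<lambda>_. Z))" if "{..<i} \<subseteq> I" for I
    using measurable_private_law_given[OF Q less_imp_le[OF \<open>i < n\<close>] that]
    unfolding D_def measurable_cong_sets[OF sets_PiP refl] .
  have D_space: "prob_space (D x)" "sets (D x) = sets (PiM {..<i} (\<lambda>_. Z))" if "x \<in> space (PiM {..<i} (\<lambda>_. P))" for x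
    using measurable_space[OF D[OF order_refl] that] by (auto simp: space_prob_algebra)
  have D': "D \<in> PiM {..<i} (\<lambda>_. P) \<rightarrow>\<^sub>M subprob_algebra (PiM {..<i} (\<lambda>_. Z))"
    by (rule measurable_prob_algebraD[OF D[OF order_refl]])
  have law_Suc: "(\<integral>\<^sup>+ z. g z \<partial>private_law_given Z Q x (Suc i)) = (\<integral>\<^sup>+ z. G (x i) z \<partial>D x)"
    if x: "x \<in> space (PiM {..<Suc i} (\<lambda>_. P))" for x
  proof -
    have x': "x \<in> space (PiM {..<Suc i} (\<lambda>_. X))"
      using x sets_eq_imp_space_eq[OF sets_PiP] by blast
    have setsD: "sets (D x) = sets (PiM {..<i} (\<lambda>_. Z))"
      using measurable_space[OF D[of "{..<Suc i}"] x] by (auto simp: space_prob_algebra)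
    have step: "(\<lambda>z. distr (Q i (x i, z)) (PiM {..<Suc i} (\<lambda>_. Z)) (\<lambda>w. z(i := w)))
       \<in> D x \<rightarrow>\<^sub>M subprob_algebra (PiM {..<Suc i} (\<lambda>_. Z))"
      unfolding measurable_cong_sets[OF setsD refl]
      using measurable_compose[OF measurable_Pair1'[OF x'] measurable_prob_algebraD[OF
            measurable_private_law_given_step[OF Q \<open>i < n\<close>, of "{..<Suc i}"]]]
      by simp
    show ?thesis
      unfolding private_law_given.simps D_def[symmetric] nn_integral_bind[OF g step]
    proof (rule nn_integral_cong)
      fix z assume "z \<in> space (D x)"
      then have z: "z \<in> space (PiM {..<i} (\<lambda>_. Z))"
        using sets_eq_imp_space_eq[OF setsD] by simp
      have "x i \<in> space X"
        using x' by (auto simp: space_PiM)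
      then have setsQ: "sets (Q i (x i, z)) = sets Z"
        using measurable_space[OF Qi, of "(x i, z)"] z by (auto simp: space_prob_algebra space_pair_measure)
      have "(\<lambda>w. z(i := w)) \<in> Q i (x i, z) \<rightarrow>\<^sub>M PiM {..<Suc i} (\<lambda>_. Z)"
        unfolding measurable_cong_sets[OF setsQ refl]
        using measurable_compose[OF measurable_Pair1'[OF z] measurable_append_observation] by simp
      then show "(\<integral>\<^sup>+ z. g z \<partial>distr (Q i (x i, z)) (PiM {..<Suc i} (\<lambda>_. Z)) (\<lambda>w. z(i := w))) = G (x i) z"
        unfolding G_def by (rule nn_integral_distr) (simp add: g)
    qed
  qed
  have law_meas: "(\<lambda>x. private_law_given Z Q x (Suc i)) \<in> PiM {..<Suc i} (\<lambda>_. P) \<rightarrow>\<^sub>M subprob_algebra (PiM {..<Suc i} (\<lambda>_. Z))"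
    unfolding measurable_cong_sets[OF sets_PiP refl]
    using measurable_private_law_given[OF Q, of "Suc i" "{..<Suc i}"] \<open>i < n\<close>
    by (intro measurable_prob_algebraD) auto
  have GD_meas: "(\<lambda>x. \<integral>\<^sup>+ z. g z \<partial>private_law_given Z Q x (Suc i)) \<in> borel_measurable (PiM {..<Suc i} (\<lambda>_. P))"
    by (rule measurable_compose[OF law_meas nn_integral_measurable_subprob_algebra[OF g]])
  have "(\<integral>\<^sup>+ z. g z \<partial>private_law Z Q P (Suc i)) =
        (\<integral>\<^sup>+ x. \<integral>\<^sup>+ z. g z \<partial>private_law_given Z Q x (Suc i) \<partial>PiM {..<Suc i} (\<lambda>_. P))"
    unfolding private_law_def by (rule nn_integral_bind[OF g law_meas])
  also have "\<dots> = (\<integral>\<^sup>+ x. \<integral>\<^sup>+ y. \<integral>\<^sup>+ z. g z \<partial>private_law_given Z Q (x(i := y)) (Suc i) \<partial>P \<partial>PiM {..<i} (\<lambda>_. P))"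
    using GD_meas unfolding lessThan_Suc by (subst PP.product_nn_integral_insert) auto
  also have "\<dots> = (\<integral>\<^sup>+ x. \<integral>\<^sup>+ y. \<integral>\<^sup>+ z. G y z \<partial>D x \<partial>P \<partial>PiM {..<i} (\<lambda>_. P))"
  proof (intro nn_integral_cong)
    fix x y assume x: "x \<in> space (PiM {..<i} (\<lambda>_. P))" and y: "y \<in> space P"
    have "x(i := y) \<in> space (PiM {..<Suc i} (\<lambda>_. P))"
      using x y by (auto simp: space_PiM PiE_def extensional_def less_Suc_eq Pi_iff)
    moreover have "D (x(i := y)) = D x"
      unfolding D_def by (rule private_law_given_cong) simp
    ultimately show "(\<integral>\<^sup>+ z. g z \<partial>private_law_given Z Q (x(i := y)) (Suc i)) = (\<integral>\<^sup>+ z. G y z \<partial>D x)"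
      by (simp add: law_Suc del: private_law_given.simps)
  qed
  also have "\<dots> = (\<integral>\<^sup>+ x. \<integral>\<^sup>+ z. \<integral>\<^sup>+ y. G y z \<partial>P \<partial>D x \<partial>PiM {..<i} (\<lambda>_. P))"
  proof (intro nn_integral_cong)
    fix x assume x: "x \<in> space (PiM {..<i} (\<lambda>_. P))"
    interpret Dx: prob_space "D x" by (rule D_space(1)[OF x])
    interpret PD: pair_sigma_finite P "D x" ..
    have "(\<lambda>(y, z). G y z) \<in> borel_measurable (P \<Otimes>\<^sub>M D x)"
      using G_meas measurable_cong_sets[OF sets_pair_measure_cong[OF sets_P D_space(2)[OF x]] refl]
      by blast
    then show "(\<integral>\<^sup>+ y. \<integral>\<^sup>+ z. G y z \<partial>D x \<partial>P) = (\<integral>\<^sup>+ z. \<integral>\<^sup>+ y. G y z \<partial>P \<partial>D x)"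
      by (rule PD.Fubini'[symmetric])
  qed
  also have "\<dots> = (\<integral>\<^sup>+ z. \<integral>\<^sup>+ y. G y z \<partial>P \<partial>private_law Z Q P i)"
  proof -
    have "(\<lambda>(y, z). G y z) \<in> borel_measurable (P \<Otimes>\<^sub>M PiM {..<i} (\<lambda>_. Z))"
      using G_meas by measurable
    then have "(\<lambda>(z, y). G y z) \<in> borel_measurable (PiM {..<i} (\<lambda>_. Z) \<Otimes>\<^sub>M P)"
      by (subst measurable_pair_swap_iff) simp
    then have "(\<lambda>z. \<integral>\<^sup>+ y. G y z \<partial>P) \<in> borel_measurable (PiM {..<i} (\<lambda>_. Z))"
      by (rule P.borel_measurable_nn_integral)
    from nn_integral_bind[OF this D'] show ?thesis
      unfolding private_law_def D_def by simp
  qed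
  also have "\<dots> = (\<integral>\<^sup>+ z. \<integral>\<^sup>+ w. g (z(i := w)) \<partial>(P \<bind> (\<lambda>x. Q i (x, z))) \<partial>private_law Z Q P i)"
  proof (intro nn_integral_cong)
    fix z assume "z \<in> space (private_law Z Q P i)"
    then have z: "z \<in> space (PiM {..<i} (\<lambda>_. Z))"
      using private_law_in_prob_algebra[OF Q less_imp_le[OF \<open>i < n\<close>] P]
      by (auto simp: space_prob_algebra dest: sets_eq_imp_space_eq)
    have "(\<lambda>x. Q i (x, z)) \<in> P \<rightarrow>\<^sub>M subprob_algebra Z"
      using z by measurable
    from nn_integral_bind[OF app[OF z] this]
    show "(\<integral>\<^sup>+ y. G y z \<partial>P) = (\<integral>\<^sup>+ w. g (z(i := w)) \<partial>(P \<bind> (\<lambda>x. Q i (x, z))))"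
      by (simp add: G_def)
  qed
  finally show ?thesis .
qed

text \<open>
  Tensorization. The last observation is integrated first: domination over the history applies to
  the conditional mean of the test function given the history, and domination for one observation
  bounds the square of this mean pointwise.
\<close>

lemma moment_dominated_private_law:
  assumes Q: "Q \<in> seq_channels X Z n" and "i \<le> n"
    and P: "P \<in> space (prob_algebra X)" and P': "P' \<in> space (prob_algebra X)" and "0 \<le> C"
    and step: "\<And>j z. \<lbrakk>j < i; z \<in> space (PiM {..<j} (\<lambda>_. Z))\<rbrakk> \<Longrightarrow>
       moment_dominated C (P \<bind> (\<lambda>x. Q j (x, z))) (P' \<bind> (\<lambda>x. Q j (x, z)))"
  shows "moment_dominated (C ^ i) (private_law Z Q P i) (private_law Z Q P' i)"
  using \<open>i \<le> n\<close> step
proof (induction i)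
  case 0
  interpret law0: prob_space "private_law Z Q P 0"
    using private_law_in_prob_algebra[OF Q _ P, of 0] by (simp add: space_prob_algebra)
  have "private_law Z Q P 0 = private_law Z Q P' 0"
    unfolding private_law_def by (simp add: PiM_empty)
  moreover have "(\<integral>\<^sup>+ x. g x \<partial>private_law Z Q P 0)\<^sup>2 \<le> (\<integral>\<^sup>+ x. (g x)\<^sup>2 \<partial>private_law Z Q P 0)"
    if "g \<in> borel_measurable (private_law Z Q P 0)" for g
    using Cauchy_Schwarz_nn_integral[OF that borel_measurable_const[of 1]]
    by (simp add: law0.emeasure_space_1)
  ultimately show ?case
    by (auto simp: moment_dominated_def)
next
  case (Suc i)
  then have "i < n" by simp
  have law_sets: "sets (private_law Z Q R j) = sets (PiM {..<j} (\<lambda>_. Z))"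
    if "R \<in> space (prob_algebra X)" "j \<le> n" for R j
    using private_law_in_prob_algebra[OF Q that(2,1)] by (simp add: space_prob_algebra)
  show ?case
    unfolding moment_dominated_def
  proof
    fix g :: "(nat \<Rightarrow> 'b) \<Rightarrow> ennreal"
    assume "g \<in> borel_measurable (private_law Z Q P' (Suc i))"
    then have g: "g \<in> borel_measurable (PiM {..<Suc i} (\<lambda>_. Z))"
      using measurable_cong_sets[OF law_sets[OF P' Suc.prems(1)] refl] by blast
    then have g2: "(\<lambda>z. (g z)\<^sup>2) \<in> borel_measurable (PiM {..<Suc i} (\<lambda>_. Z))"
      by measurable
    define k where "k R z = R \<bind> (\<lambda>x. Q i (x, z))" for R z
    have "Q i \<in> X \<Otimes>\<^sub>M PiM {..<i} (\<lambda>_. Z) \<rightarrow>\<^sub>M prob_algebra Z"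
      using Q \<open>i < n\<close> by (auto simp: seq_channels_def)
    then have k: "k R \<in> PiM {..<i} (\<lambda>_. Z) \<rightarrow>\<^sub>M prob_algebra Z" if "R \<in> space (prob_algebra X)" for R
      unfolding k_def
      by (intro measurable_bind_prob_space2[where N=X] measurable_const that)
         (simp add: case_prod_beta', measurable)
    define G where "G z = (\<integral>\<^sup>+ w. g (z(i := w)) \<partial>k P z)" for z
    have G: "G \<in> borel_measurable (PiM {..<i} (\<lambda>_. Z))"
      unfolding G_def
      using measurable_compose[OF measurable_append_observation g]
      by (intro nn_integral_measurable_subprob_algebra2[OF _ measurable_prob_algebraD[OF k[OF P]]])
         (simp add: case_prod_beta')
    have "(\<integral>\<^sup>+ z. g z \<partial>private_law Z Q P (Suc i))\<^sup>2 = (\<integral>\<^sup>+ z. G z \<partial>private_law Z Q P i)\<^sup>2"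
      unfolding nn_integral_private_law_Suc[OF Q \<open>i < n\<close> P g] G_def k_def ..
    also have "\<dots> \<le> ennreal (C ^ i) * (\<integral>\<^sup>+ z. (G z)\<^sup>2 \<partial>private_law Z Q P' i)"
    proof -
      have "moment_dominated (C ^ i) (private_law Z Q P i) (private_law Z Q P' i)"
        using Suc by auto
      moreover have "G \<in> borel_measurable (private_law Z Q P' i)"
        using G measurable_cong_sets[OF law_sets[OF P' less_imp_le[OF \<open>i < n\<close>]] refl] by blast
      ultimately show ?thesis
        by (auto simp: moment_dominated_def)
    qed
    also have "\<dots> \<le> ennreal (C ^ i) *
        (\<integral>\<^sup>+ z. ennreal C * (\<integral>\<^sup>+ w. (g (z(i := w)))\<^sup>2 \<partial>k P' z) \<partial>private_law Z Q P' i)"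
    proof (intro mult_left_mono nn_integral_mono)
      fix z assume "z \<in> space (private_law Z Q P' i)"
      then have z: "z \<in> space (PiM {..<i} (\<lambda>_. Z))"
        using sets_eq_imp_space_eq[OF law_sets[OF P' less_imp_le[OF \<open>i < n\<close>]]] by simp
      have "(\<lambda>w. g (z(i := w))) \<in> borel_measurable Z"
        using measurable_compose[OF measurable_Pair1'[OF z] measurable_compose[OF measurable_append_observation g]]
        by simp
      moreover have "sets (k P' z) = sets Z"
        using measurable_space[OF k[OF P'] z] by (simp add: space_prob_algebra)
      ultimately have "(\<lambda>w. g (z(i := w))) \<in> borel_measurable (k P' z)"
        using measurable_cong_sets by blast
      moreover have "moment_dominated C (k P z) (k P' z)"
        unfolding k_def using Suc.prems(2) z by auto
      ultimately show "(G z)\<^sup>2 \<le> ennreal C * (\<integral>\<^sup>+ w. (g (z(i := w)))\<^sup>2 \<partial>k P' z)"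
        by (auto simp: moment_dominated_def G_def)
    qed simp
    also have "\<dots> = ennreal (C ^ i) * (ennreal C *
        (\<integral>\<^sup>+ z. \<integral>\<^sup>+ w. (g (z(i := w)))\<^sup>2 \<partial>k P' z \<partial>private_law Z Q P' i))"
    proof (subst nn_integral_cmult)
      have "(\<lambda>z. \<integral>\<^sup>+ w. (g (z(i := w)))\<^sup>2 \<partial>k P' z) \<in> borel_measurable (PiM {..<i} (\<lambda>_. Z))"
        using measurable_compose[OF measurable_append_observation g2]
        by (intro nn_integral_measurable_subprob_algebra2[OF _ measurable_prob_algebraD[OF k[OF P']]])
           (simp add: case_prod_beta')
      then show "(\<lambda>z. \<integral>\<^sup>+ w. (g (z(i := w)))\<^sup>2 \<partial>k P' z) \<in> borel_measurable (private_law Z Q P' i)"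
        using measurable_cong_sets[OF law_sets[OF P' less_imp_le[OF \<open>i < n\<close>]] refl] by blast
    qed simp
    also have "\<dots> = ennreal (C ^ Suc i) * (\<integral>\<^sup>+ z. (g z)\<^sup>2 \<partial>private_law Z Q P' (Suc i))"
      unfolding nn_integral_private_law_Suc[OF Q \<open>i < n\<close> P' g2] k_def
      using \<open>0 \<le> C\<close> by (simp add: ennreal_mult mult.assoc mult.commute mult.left_commute)
    finally show "(\<integral>\<^sup>+ z. g z \<partial>private_law Z Q P (Suc i))\<^sup>2 \<le> \<dots>" .
  qed
qed

section \<open>From two laws to the risk\<close>

text \<open>
  Since \<open>\<bar>t - s\<bar> \<le> \<bar>T - s\<bar> + \<bar>T - t\<bar>\<close>, integration with respect to \<open>N\<close> bounds \<open>\<bar>t - s\<bar>\<close> by a sum of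
  two means. The second is controlled by the risk under \<open>N\<close>, the first by the risk under \<open>M\<close> at
  the price of the factor \<open>a\<close>.
\<close>

lemma two_point_lower_bound:
  assumes "prob_space M" and N: "prob_space N" and sets_eq: "sets M = sets N"
    and dom: "moment_dominated (a\<^sup>2) N M" and "0 \<le> a"
    and T[measurable]: "T \<in> borel_measurable M"
  shows "ennreal ((\<bar>t - s\<bar> / (1 + a))\<^sup>2) \<le>
         max (\<integral>\<^sup>+ z. ennreal ((T z - s)\<^sup>2) \<partial>M) (\<integral>\<^sup>+ z. ennreal ((T z - t)\<^sup>2) \<partial>N)"
    (is "_ \<le> ?risk")
proof (cases ?risk)
  case (real r)
  interpret M: prob_space M by fact
  interpret N: prob_space N by fact
  have TN[measurable]: "T \<in> borel_measurable N"
    using T measurable_cong_sets[OF sets_eq refl] by blast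
  have "(\<integral>\<^sup>+ z. ennreal ((T z - s)\<^sup>2) \<partial>M) \<le> ennreal r"
    "(\<integral>\<^sup>+ z. ennreal ((T z - t)\<^sup>2) \<partial>N) \<le> ennreal r"
    unfolding real(2)[symmetric] by (rule max.cobounded1, rule max.cobounded2)
  then have risk_le: "(\<integral>\<^sup>+ z. (ennreal \<bar>T z - s\<bar>)\<^sup>2 \<partial>M) \<le> ennreal r"
    "(\<integral>\<^sup>+ z. (ennreal \<bar>T z - t\<bar>)\<^sup>2 \<partial>N) \<le> ennreal r"
    by (simp_all add: ennreal_power)
  have le_sqrt: "x \<le> ennreal (sqrt u)" if "x\<^sup>2 \<le> ennreal u" "0 \<le> u" for x :: ennreal and u
  proof (cases x)
    case (real y)
    with that have "y\<^sup>2 \<le> u" by (simp add: ennreal_power)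
    then show ?thesis
      using real by (simp add: real_le_rsqrt ennreal_leI)
  next
    case top
    with that show ?thesis by (simp add: power2_eq_square ennreal_top_mult top_unique)
  qed
  have "(\<integral>\<^sup>+ z. ennreal \<bar>T z - t\<bar> \<partial>N)\<^sup>2 \<le> (\<integral>\<^sup>+ z. (ennreal \<bar>T z - t\<bar>)\<^sup>2 \<partial>N)"
    using Cauchy_Schwarz_nn_integral[of "\<lambda>z. ennreal \<bar>T z - t\<bar>" N "\<lambda>_. 1"]
    by (simp add: N.emeasure_space_1)
  also have "\<dots> \<le> ennreal r" by (rule risk_le)
  finally have bound_t: "(\<integral>\<^sup>+ z. ennreal \<bar>T z - t\<bar> \<partial>N) \<le> ennreal (sqrt r)"
    using real by (intro le_sqrt) auto
  have "(\<integral>\<^sup>+ z. ennreal \<bar>T z - s\<bar> \<partial>N)\<^sup>2 \<le> ennreal (a\<^sup>2) * (\<integral>\<^sup>+ z. (ennreal \<bar>T z - s\<bar>)\<^sup>2 \<partial>M)"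
    using dom unfolding moment_dominated_def by (rule bspec) measurable
  also have "\<dots> \<le> ennreal (a\<^sup>2) * ennreal r"
    by (intro mult_left_mono risk_le) simp
  also have "\<dots> = ennreal (a\<^sup>2 * r)"
    by (simp add: ennreal_mult real)
  finally have "(\<integral>\<^sup>+ z. ennreal \<bar>T z - s\<bar> \<partial>N) \<le> ennreal (sqrt (a\<^sup>2 * r))"
    using real by (intro le_sqrt) auto
  then have bound_s: "(\<integral>\<^sup>+ z. ennreal \<bar>T z - s\<bar> \<partial>N) \<le> ennreal (a * sqrt r)"
    using \<open>0 \<le> a\<close> by (simp add: real_sqrt_mult)
  have "ennreal \<bar>t - s\<bar> = (\<integral>\<^sup>+ z. ennreal \<bar>t - s\<bar> \<partial>N)"
    by (simp add: N.emeasure_space_1)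
  also have "\<dots> \<le> (\<integral>\<^sup>+ z. ennreal \<bar>T z - s\<bar> + ennreal \<bar>T z - t\<bar> \<partial>N)"
  proof (rule nn_integral_mono)
    fix z
    have "\<bar>t - s\<bar> \<le> \<bar>T z - s\<bar> + \<bar>T z - t\<bar>" by linarith
    then show "ennreal \<bar>t - s\<bar> \<le> ennreal \<bar>T z - s\<bar> + ennreal \<bar>T z - t\<bar>"
      by (metis abs_ge_zero ennreal_leI ennreal_plus)
  qed
  also have "\<dots> = (\<integral>\<^sup>+ z. ennreal \<bar>T z - s\<bar> \<partial>N) + (\<integral>\<^sup>+ z. ennreal \<bar>T z - t\<bar> \<partial>N)"
    by (rule nn_integral_add) measurable
  also have "\<dots> \<le> ennreal (a * sqrt r) + ennreal (sqrt r)"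
    by (intro add_mono bound_s bound_t)
  also have "\<dots> = ennreal ((1 + a) * sqrt r)"
    using \<open>0 \<le> a\<close> real by (subst ennreal_plus[symmetric]) (auto simp: algebra_simps)
  finally have "\<bar>t - s\<bar> \<le> (1 + a) * sqrt r"
    using \<open>0 \<le> a\<close> real by (subst (asm) ennreal_le_iff) auto
  then have "\<bar>t - s\<bar> / (1 + a) \<le> sqrt r"
    using \<open>0 \<le> a\<close> by (simp add: field_simps)
  then have "(\<bar>t - s\<bar> / (1 + a))\<^sup>2 \<le> (sqrt r)\<^sup>2"
    using \<open>0 \<le> a\<close> by (intro power_mono) auto
  then show ?thesis
    using real by (simp add: ennreal_leI)
qed simp

text \<open>
  The constants come together here. Since \<open>exp (\<epsilon>\<^sup>2) - 1 \<le> 2 \<epsilon>\<^sup>2\<close> for \<open>\<epsilon> \<le> 1\<close>, the radius makes the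
  factor of one observation at most \<open>1 + 1 / n\<close>. The product of the factors is then at most
  \<open>exp 1\<close>, hence at most \<open>3\<^sup>2\<close>, and \<open>a = 3\<close> in the two-point bound gives the denominator \<open>4\<close>.
\<close>

lemma channel_risk_lower_bound:
  assumes P: "P \<in> space (prob_algebra X)" and P0: "P0 \<in> space (prob_algebra X)"
    and "0 < \<epsilon>" "\<epsilon> \<le> 1" and "1 \<le> n"
    and Q: "Q \<in> renyi_channels X Z n \<epsilon>" and T: "T \<in> borel_measurable (PiM {..<n} (\<lambda>_. Z))"
    and tv: "tv_dist P P0 \<le> 1 / (2 * sqrt (2 * real n * \<epsilon>\<^sup>2))"
  shows "ennreal ((\<bar>\<theta> P - \<theta> P0\<bar> / 4)\<^sup>2) \<le>
         max (risk Z n sq_loss \<theta> T Q P0) (risk Z n sq_loss \<theta> T Q P)"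
proof -
  have Qs: "Q \<in> seq_channels X Z n"
    and renyi: "\<And>i x x' z. \<lbrakk>i < n; x \<in> space X; x' \<in> space X; z \<in> space (PiM {..<i} (\<lambda>_. Z))\<rbrakk>
          \<Longrightarrow> renyi_div2 (Q i (x, z)) (Q i (x', z)) \<le> ereal (\<epsilon>\<^sup>2)"
    using Q by (auto simp: renyi_channels_def)
  define \<delta> where "\<delta> = 1 / (2 * sqrt (2 * real n * \<epsilon>\<^sup>2))"
  define C where "C = 1 + 4 * \<delta>\<^sup>2 * (exp (\<epsilon>\<^sup>2) - 1)"
  have \<epsilon>2: "0 < \<epsilon>\<^sup>2" "\<epsilon>\<^sup>2 \<le> 1"
    using assms(3,4) by (auto simp: power_le_one)
  have "(\<epsilon>\<^sup>2)\<^sup>2 \<le> \<epsilon>\<^sup>2"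
    unfolding power2_eq_square[of "\<epsilon>\<^sup>2"] using \<epsilon>2 by (intro mult_left_le) auto
  then have exp_\<epsilon>2_le: "exp (\<epsilon>\<^sup>2) - 1 \<le> 2 * \<epsilon>\<^sup>2"
    using exp_bound[of "\<epsilon>\<^sup>2"] \<epsilon>2 by linarith
  have "C \<le> 1 + 4 * \<delta>\<^sup>2 * (2 * \<epsilon>\<^sup>2)"
    unfolding C_def using exp_\<epsilon>2_le by (intro add_left_mono mult_left_mono) auto
  also have "\<dots> = 1 + 1 / real n"
    using \<open>1 \<le> n\<close> \<epsilon>2 by (simp add: \<delta>_def power_divide power_mult_distrib)
  also have "\<dots> \<le> exp (1 / real n)"
    by (rule exp_ge_add_one_self)
  finally have C_le: "C \<le> exp (1 / real n)" .
  have "1 \<le> C"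
    unfolding C_def using \<epsilon>2 by simp
  then have "C ^ n \<le> exp (1 / real n) ^ n"
    using C_le by (intro power_mono) auto
  also have "\<dots> = exp 1"
    using \<open>1 \<le> n\<close> by (simp flip: exp_of_nat_mult)
  also have "\<dots> \<le> 3\<^sup>2"
    using exp_le by simp
  finally have Cn: "C ^ n \<le> 3\<^sup>2" .
  have "moment_dominated (C ^ n) (private_law Z Q P n) (private_law Z Q P0 n)"
  proof (rule moment_dominated_private_law[OF Qs order_refl P P0])
    fix i z assume "i < n" and z: "z \<in> space (PiM {..<i} (\<lambda>_. Z))"
    have Qi: "Q i \<in> X \<Otimes>\<^sub>M PiM {..<i} (\<lambda>_. Z) \<rightarrow>\<^sub>M prob_algebra Z"
      using Qs \<open>i < n\<close> by (auto simp: seq_channels_def)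
    have K: "(\<lambda>x. Q i (x, z)) \<in> X \<rightarrow>\<^sub>M prob_algebra Z"
      using measurable_compose[OF measurable_Pair2'[OF z] Qi] .
    show "moment_dominated C (P \<bind> (\<lambda>x. Q i (x, z))) (P0 \<bind> (\<lambda>x. Q i (x, z)))"
      unfolding C_def
    proof (rule moment_dominated_kernel_mixture[OF P P0 K])
      fix x x' assume x: "x \<in> space X" and x': "x' \<in> space X"
      show "moment_dominated (exp (\<epsilon>\<^sup>2)) (Q i (x, z)) (Q i (x', z))"
        using measurable_space[OF K x] measurable_space[OF K x'] renyi[OF \<open>i < n\<close> x x' z]
        by (intro renyi_div2_le_imp_moment_dominated) (auto simp: space_prob_algebra)
    qed (use \<epsilon>2 tv in \<open>auto simp: \<delta>_def\<close>)
  qed (use \<open>1 \<le> C\<close> in simp)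
  then have dom: "moment_dominated (3\<^sup>2) (private_law Z Q P n) (private_law Z Q P0 n)"
    using ennreal_leI[OF Cn] unfolding moment_dominated_def
    by (meson mult_right_mono order_trans zero_le)
  have laws: "prob_space (private_law Z Q R n)" "sets (private_law Z Q R n) = sets (PiM {..<n} (\<lambda>_. Z))"
    if "R \<in> space (prob_algebra X)" for R
    using private_law_in_prob_algebra[OF Qs order_refl that] by (auto simp: space_prob_algebra)
  have "T \<in> borel_measurable (private_law Z Q P0 n)"
    using T measurable_cong_sets[OF laws(2)[OF P0] refl] by blast
  with two_point_lower_bound[OF laws(1)[OF P0] laws(1)[OF P] _ dom, of T "\<theta> P" "\<theta> P0"]
  show ?thesis
    by (simp add: laws P P0 risk_def sq_loss_def)
qed

theorem corollary1:
  fixes X :: "'x measure" and Z :: "'z measure"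
    and \<P> :: "'x measure set" and \<theta> :: "'x measure \<Rightarrow> real"
    and P0 :: "'x measure" and \<epsilon> :: real and n :: nat
  assumes "\<P> \<subseteq> space (prob_algebra X)"
    and "P0 \<in> \<P>"
    and "0 < \<epsilon>" and "\<epsilon> \<le> 1"
    and "1 \<le> n"
  shows "local_minimax_risk Z n \<theta> P0 sq_loss \<P> (renyi_channels X Z n \<epsilon>)
         \<ge> ennreal (1 / 16) * (tv_modulus \<theta> (1 / (2 * sqrt (2 * real n * \<epsilon>\<^sup>2))) P0 \<P>)\<^sup>2"
    (is "?R \<ge> ennreal (1 / 16) * (tv_modulus \<theta> ?\<delta> P0 \<P>)\<^sup>2")
proof (cases ?R)
  case (real r)
  have "tv_modulus \<theta> ?\<delta> P0 \<P> \<le> ennreal (4 * sqrt r)"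
    unfolding tv_modulus_def
  proof (rule SUP_least)
    fix P assume "P \<in> {P \<in> \<P>. tv_dist P P0 \<le> ?\<delta>}"
    then have P: "P \<in> \<P>" and tv: "tv_dist P P0 \<le> ?\<delta>" by auto
    have "ennreal ((\<bar>\<theta> P - \<theta> P0\<bar> / 4)\<^sup>2) \<le>
        (INF (T, Q) \<in> borel_measurable (PiM {..<n} (\<lambda>_. Z)) \<times> renyi_channels X Z n \<epsilon>.
          max (risk Z n sq_loss \<theta> T Q P0) (risk Z n sq_loss \<theta> T Q P))"
      using P assms(1,2)
      by (auto intro!: INF_greatest channel_risk_lower_bound[where X=X, OF _ _ assms(3-5) _ _ tv])
    also have "\<dots> \<le> ?R"
      unfolding local_minimax_risk_def by (rule SUP_upper) (rule P)
    finally have "(\<bar>\<theta> P - \<theta> P0\<bar> / 4)\<^sup>2 \<le> r"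
      using real by simp
    then have "\<bar>\<theta> P - \<theta> P0\<bar> / 4 \<le> sqrt r"
      by (rule real_le_rsqrt)
    then show "ennreal \<bar>\<theta> P - \<theta> P0\<bar> \<le> ennreal (4 * sqrt r)"
      by (intro ennreal_leI) simp
  qed
  then have "ennreal (1 / 16) * (tv_modulus \<theta> ?\<delta> P0 \<P>)\<^sup>2 \<le> ennreal (1 / 16) * (ennreal (4 * sqrt r))\<^sup>2"
    by (intro mult_left_mono power_mono) auto
  also have "\<dots> = ennreal r"
    using real by (simp add: ennreal_power power_mult_distrib flip: ennreal_mult)
  finally show ?thesis
    using real by simp
qed simp

end
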